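(* Let $H$ be a finite dimensional $*$-Hopf algebra and let $V\in{}^H_H\mathcal{YD}$ be a left-left Yetter–Drinfel'd module over $H$, regarded also as a left $D(H)$-module. Let $\langle\ ,\ \rangle$ be a Hermitian form on $V$. Then $\langle\ ,\ \rangle$ is invariant for the $D(H)$-module structure if and only if it is simultaneously invariant for the $H$-module structure and for the $H$-comodule structure.
   Context: All vector spaces are over $\mathbb C$; Sweedler notation is used. A $*$-Hopf algebra is a Hopf algebra with a conjugate linear involution $*$ that is antimultiplicative and comultiplicative ($\Delta(x^* )=\sum x_1^*\otimes x_2^*$). Hermitian forms are linear in the first variable. Let $H$ be a finite dimensional $*$-Hopf algebra with antipode $\mathcal S$, and $H^\vee$ the dual Hopf algebra (convolution product, coproduct determined by $\alpha(xy)=\sum\alpha_1(x)\alpha_2(y)$), with involution $\alpha^*(x)=\overline{\alpha(\mathcal S(x)^* )}$. Put $(x\rightharpoonup\alpha)(y)=\alpha(yx)$, $(\alpha\leftharpoonup x)(y)=\alpha(xy)$. The quantum double $D(H)$ is the vector space $H^\vee\otimes H$ (write $\alpha x$ for $\alpha\otimes x$) with product $(\alpha x)(\beta y)=\sum\alpha\big(x_1\rightharpoonup\beta\leftharpoonup\mathcal S^{-1}(x_3)\big)x_2y$, coproduct $\Delta(\alpha x)=\sum\alpha_2x_1\otimes\alpha_1x_2$, tensor unit and counit; it is a $*$-Hopf algebra with the involution $(\alpha x)^*=x^*\alpha^*$ (product in $D(H)$), and it contains $H$ and $H^\vee$ as $*$-subalgebras. An object of ${}^H_H\mathcal{YD}$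 is a left $H$-module and left $H$-comodule $V$ (coaction $v\mapsto\sum v_{-1}\otimes v_0$) with $\sum(x\cdot v)_{-1}\otimes(x\cdot v)_0=\sum x_1v_{-1}\mathcal S(x_3)\otimes x_2\cdot v_0$. It is a $D(H)$-module via $(\alpha x)\cdot v=\alpha\cdot(x\cdot v)$, where $H^\vee$ acts by $\mathcal S(\alpha)\cdot v=\sum\alpha(v_{-1})v_0$, equivalently $\alpha\cdot v=\sum\alpha(\mathcal S^{-1}(v_{-1}))v_0$. A form $\langle\ ,\ \rangle$ on a left module $V$ over a $*$-algebra $B$ is invariant for the module structure if $\langle b\cdot u,v\rangle=\langle u,b^*\cdot v\rangle$ for all $b\in B$, $u,v\in V$. It is invariant for a left $H$-comodule structure if $\sum\mathcal S^{-1}(u_{-1})\langle u_0,v\rangle=\sum v_{-1}^*\langle u,v_0\rangle$ for all $u,v\in V$. *)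

theory Defs
  imports Complex_Main "HOL-Library.Multiset"
begin

section \<open>Complex vector spaces\<close>

class complex_vector = ab_group_add +
  fixes scaleC :: "complex \<Rightarrow> 'a \<Rightarrow> 'a" (infixr "*\<^sub>C" 75)
  assumes scaleC_add_right: "c *\<^sub>C (x + y) = c *\<^sub>C x + c *\<^sub>C y"
    and scaleC_add_left: "(c + d) *\<^sub>C x = c *\<^sub>C x + d *\<^sub>C x"
    and scaleC_scaleC: "c *\<^sub>C (d *\<^sub>C x) = (c * d) *\<^sub>C x"
    and scaleC_one: "1 *\<^sub>C x = x"

global_interpretation complex_vector:
  vector_space "scaleC :: complex \<Rightarrow> 'a \<Rightarrow> 'a::complex_vector"
  by unfold_locales (fact scaleC_add_right scaleC_add_left scaleC_scaleC scaleC_one)+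

instantiation complex :: complex_vector
begin

definition scaleC_complex :: "complex \<Rightarrow> complex \<Rightarrow> complex"
  where "scaleC_complex = (*)"

instance
  by standard (simp_all add: scaleC_complex_def algebra_simps)

end

abbreviation clinear :: "('a::complex_vector \<Rightarrow> 'b::complex_vector) \<Rightarrow> bool"
  where "clinear \<equiv> Vector_Spaces.linear (*\<^sub>C) (*\<^sub>C)"

definition cbilinear ::
    "('a::complex_vector \<Rightarrow> 'b::complex_vector \<Rightarrow> 'c::complex_vector) \<Rightarrow> bool"
  where "cbilinear f \<longleftrightarrow> (\<forall>x. clinear (f x)) \<and> (\<forall>y. clinear (\<lambda>x. f x y))"

definition conjugate_linear :: "('a::complex_vector \<Rightarrow> 'b::complex_vector) \<Rightarrow> bool"
  where "conjugate_linear f \<longleftrightarrow>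
    (\<forall>x y. f (x + y) = f x + f y) \<and> (\<forall>c x. f (c *\<^sub>C x) = cnj c *\<^sub>C f x)"

lemma clinearI:
  assumes "\<And>x y. f (x + y) = f x + f y" and "\<And>c x. f (c *\<^sub>C x) = c *\<^sub>C f x"
  shows "clinear f"
  using assms by unfold_locales auto

lemma clinear_add: "clinear f \<Longrightarrow> f (x + y) = f x + f y"
  by (simp add: Vector_Spaces.linear.axioms module_hom.add Vector_Spaces.linear_iff_module_hom)

lemma clinear_scaleC: "clinear f \<Longrightarrow> f (c *\<^sub>C x) = c *\<^sub>C f x"
  by (simp add: module_hom.scale Vector_Spaces.linear_iff_module_hom)


section \<open>The dual space\<close>

typedef (overloaded) 'a dual = "{f :: 'a::complex_vector \<Rightarrow> complex. clinear f}"
  morphisms dual_apply Abs_dual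
  by (rule exI[of _ "\<lambda>_. 0"]) (auto intro: clinearI)

setup_lifting type_definition_dual

instantiation dual :: (complex_vector) complex_vector
begin

lift_definition zero_dual :: "'a dual" is "\<lambda>_. 0"
  by (auto intro: clinearI)

lift_definition plus_dual :: "'a dual \<Rightarrow> 'a dual \<Rightarrow> 'a dual" is "\<lambda>f g x. f x + g x"
  by (auto intro!: clinearI simp: clinear_add clinear_scaleC scaleC_add_right)

lift_definition uminus_dual :: "'a dual \<Rightarrow> 'a dual" is "\<lambda>f x. - f x"
  by (auto intro!: clinearI simp: clinear_add clinear_scaleC)

lift_definition minus_dual :: "'a dual \<Rightarrow> 'a dual \<Rightarrow> 'a dual" is "\<lambda>f g x. f x - g x"
  by (auto intro!: clinearI
      simp: clinear_add clinear_scaleC complex_vector.scale_right_diff_distrib)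

lift_definition scaleC_dual :: "complex \<Rightarrow> 'a dual \<Rightarrow> 'a dual" is "\<lambda>c f x. c *\<^sub>C f x"
  by (auto intro!: clinearI simp: clinear_add clinear_scaleC scaleC_add_right
      scaleC_scaleC mult.commute)

instance
  by standard (transfer; simp add: fun_eq_iff scaleC_add_right scaleC_add_left
      scaleC_scaleC scaleC_one)+

end


section \<open>Tensor products\<close>

text \<open>
  A tensor is a class of finite formal sums of pairs (a finite formal sum being a multiset, i.e. an
  element of the free commutative monoid) modulo the congruence generated by the bilinearity
  relations.
\<close>

inductive tensor_eq ::
    "('a::complex_vector \<times> 'b::complex_vector) multiset \<Rightarrow> ('a \<times> 'b) multiset \<Rightarrow> bool"
  where
    refl: "tensor_eq M M"
  | sym: "tensor_eq M N \<Longrightarrow> tensor_eq N M"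
  | trans: "tensor_eq M N \<Longrightarrow> tensor_eq N K \<Longrightarrow> tensor_eq M K"
  | cong: "tensor_eq M N \<Longrightarrow> tensor_eq (M + K) (N + K)"
  | add_left: "tensor_eq {#(a + a', b)#} {#(a, b), (a', b)#}"
  | add_right: "tensor_eq {#(a, b + b')#} {#(a, b), (a, b')#}"
  | balanced: "tensor_eq {#(c *\<^sub>C a, b)#} {#(a, c *\<^sub>C b)#}"
  | zero: "tensor_eq {#(0, b)#} {#}"

lemma tensor_eq_add:
  assumes "tensor_eq M M'" "tensor_eq N N'" shows "tensor_eq (M + N) (M' + N')"
  using assms by (metis add.commute tensor_eq.cong tensor_eq.trans)

quotient_type (overloaded) ('a, 'b) tensor =
    "('a::complex_vector \<times> 'b::complex_vector) multiset" / tensor_eq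
  by (intro equivpI reflpI sympI transpI) (blast intro: tensor_eq.intros)+

lift_definition pure_tensor ::
    "'a::complex_vector \<Rightarrow> 'b::complex_vector \<Rightarrow> ('a, 'b) tensor" (infixr "\<otimes>" 72)
  is "\<lambda>a b. {#(a, b)#}" .

lemma tensor_eq_scale:
  assumes "tensor_eq M N"
  shows "tensor_eq (image_mset (\<lambda>(a, b). (c *\<^sub>C a, b)) M) (image_mset (\<lambda>(a, b). (c *\<^sub>C a, b)) N)"
  using assms
proof induction
  case (balanced d a b)
  have "tensor_eq {#(d *\<^sub>C c *\<^sub>C a, b)#} {#(c *\<^sub>C a, d *\<^sub>C b)#}"
    by (rule tensor_eq.balanced)
  then show ?case
    by (simp add: mult.commute)
qed (auto simp: scaleC_add_right intro: tensor_eq.intros)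

lemma tensor_eq_scale_add:
  "tensor_eq (image_mset (\<lambda>(a, b). ((c + d) *\<^sub>C a, b)) M)
     (image_mset (\<lambda>(a, b). (c *\<^sub>C a, b)) M + image_mset (\<lambda>(a, b). (d *\<^sub>C a, b)) M)"
proof (induction M)
  case empty
  then show ?case by (simp add: tensor_eq.refl)
next
  case (add p M)
  obtain a b where p: "p = (a, b)" by (cases p)
  have "tensor_eq {#((c + d) *\<^sub>C a, b)#} {#(c *\<^sub>C a, b), (d *\<^sub>C a, b)#}"
    by (simp add: scaleC_add_left tensor_eq.add_left)
  from tensor_eq_add[OF this add] show ?case
    by (simp add: p add_mset_commute)
qed

lemma tensor_eq_uminus:
  "tensor_eq (image_mset (\<lambda>(a, b). (- 1 *\<^sub>C a, b)) M + M) {#}"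
proof (induction M)
  case empty
  then show ?case by (simp add: tensor_eq.refl)
next
  case (add p M)
  obtain a b where p: "p = (a, b)" by (cases p)
  have "tensor_eq {#(- 1 *\<^sub>C a, b), (a, b)#} {#(- 1 *\<^sub>C a + a, b)#}"
    by (rule tensor_eq.sym, rule tensor_eq.add_left)
  then have "tensor_eq {#(- 1 *\<^sub>C a, b), (a, b)#} {#}"
    by (auto intro: tensor_eq.trans tensor_eq.zero)
  from tensor_eq_add[OF this add] show ?case
    by (simp add: p add_mset_commute)
qed

instantiation tensor :: (complex_vector, complex_vector) complex_vector
begin

lift_definition zero_tensor :: "('a, 'b) tensor" is "{#}" .

lift_definition plus_tensor :: "('a, 'b) tensor \<Rightarrow> ('a, 'b) tensor \<Rightarrow> ('a, 'b) tensor"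
  is "(+)" by (rule tensor_eq_add)

lift_definition scaleC_tensor :: "complex \<Rightarrow> ('a, 'b) tensor \<Rightarrow> ('a, 'b) tensor"
  is "\<lambda>c. image_mset (\<lambda>(a, b). (c *\<^sub>C a, b))" by (rule tensor_eq_scale)

definition uminus_tensor :: "('a, 'b) tensor \<Rightarrow> ('a, 'b) tensor"
  where "uminus_tensor t = (- 1) *\<^sub>C t"

definition minus_tensor :: "('a, 'b) tensor \<Rightarrow> ('a, 'b) tensor \<Rightarrow> ('a, 'b) tensor"
  where "minus_tensor s t = s + (- 1) *\<^sub>C t"

instance
proof
  fix r s t :: "('a, 'b) tensor" and c d :: complex
  show "r + s + t = r + (s + t)"
    by transfer (simp add: add.assoc tensor_eq.refl)
  show "s + t = t + s"
    by transfer (simp add: add.commute tensor_eq.refl)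
  show "0 + t = t"
    by transfer (simp add: tensor_eq.refl)
  show "- t + t = 0"
    unfolding uminus_tensor_def by transfer (rule tensor_eq_uminus)
  show "s - t = s + - t"
    by (simp add: minus_tensor_def uminus_tensor_def)
  show "c *\<^sub>C (s + t) = c *\<^sub>C s + c *\<^sub>C t"
    by transfer (simp add: tensor_eq.refl)
  show "(c + d) *\<^sub>C t = c *\<^sub>C t + d *\<^sub>C t"
    by transfer (rule tensor_eq_scale_add)
  show "c *\<^sub>C d *\<^sub>C t = (c * d) *\<^sub>C t"
    by transfer (simp add: multiset.map_comp comp_def case_prod_unfold scaleC_scaleC tensor_eq.refl)
  show "1 *\<^sub>C t = t"
    by transfer (simp add: scaleC_one tensor_eq.refl)
qed

end

text \<open>
  Sweedler notation: if \<open>t = \<Sum>\<^sub>i a\<^sub>i \<otimes> b\<^sub>i\<close>, then \<open>sweedler f t = \<Sum>\<^sub>i f a\<^sub>i b\<^sub>i\<close>. The definition picks some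
  presentation of \<open>t\<close>; by the lemma below, the value does not depend on it when \<open>f\<close> is biadditive
  and balanced. This covers bilinear \<open>f\<close>, but also maps that are conjugate linear in both arguments,
  such as \<open>\<lambda>a b. a\<^sup>* \<otimes> b\<^sup>*\<close>.
\<close>

definition sweedler ::
    "('a::complex_vector \<Rightarrow> 'b::complex_vector \<Rightarrow> 'c::comm_monoid_add) \<Rightarrow> ('a, 'b) tensor \<Rightarrow> 'c"
  where "sweedler f t = (\<Sum>p\<in>#rep_tensor t. f (fst p) (snd p))"

lemma sweedler_abs_tensor:
  fixes f :: "'a::complex_vector \<Rightarrow> 'b::complex_vector \<Rightarrow> 'c::ab_group_add"
  assumes add_left: "\<And>a a' b. f (a + a') b = f a b + f a' b"
    and add_right: "\<And>a b b'. f a (b + b') = f a b + f a b'"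
    and balanced: "\<And>c a b. f (c *\<^sub>C a) b = f a (c *\<^sub>C b)"
  shows "sweedler f (abs_tensor M) = (\<Sum>p\<in>#M. f (fst p) (snd p))"
proof -
  have eq: "(\<Sum>p\<in>#M. f (fst p) (snd p)) = (\<Sum>p\<in>#N. f (fst p) (snd p))"
    if "tensor_eq M N" for M N
    using that
  proof induction
    case (zero b)
    have "f 0 b = 0"
      using add_left[of 0 0 b] by simp
    then show ?case by simp
  qed (auto simp: add_left add_right balanced)
  have "tensor_eq (rep_tensor (abs_tensor M)) M"
    using Quotient3_tensor Quotient3_rep_abs tensor_eq.refl by metis
  then show ?thesis
    unfolding sweedler_def by (rule eq)
qed


section \<open>Star algebras and star Hopf algebras\<close>

record 'a star_alg =
  mul :: "'a \<Rightarrow> 'a \<Rightarrow> 'a" (infixl "\<cdot>\<index>" 74)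
  unit :: "'a" ("\<one>\<index>")
  star :: "'a \<Rightarrow> 'a"

record (overloaded) 'a star_hopf = "'a star_alg" +
  comult :: "'a \<Rightarrow> ('a, 'a) tensor"
  counit :: "'a \<Rightarrow> complex"
  antipode :: "'a \<Rightarrow> 'a"

text \<open>\<open>sweedler3 H f x = \<Sum> f x\<^sub>1 x\<^sub>2 x\<^sub>3\<close>\<close>

definition sweedler3 ::
    "('h::complex_vector, 'm) star_hopf_scheme \<Rightarrow> ('h \<Rightarrow> 'h \<Rightarrow> 'h \<Rightarrow> 'c::comm_monoid_add) \<Rightarrow> 'h \<Rightarrow> 'c"
  where "sweedler3 H f x =
    sweedler (\<lambda>x\<^sub>1 y. sweedler (\<lambda>x\<^sub>2 x\<^sub>3. f x\<^sub>1 x\<^sub>2 x\<^sub>3) (comult H y)) (comult H x)"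

locale star_algebra =
  fixes A :: "('a::complex_vector, 'm) star_alg_scheme" (structure)
  assumes mul_bilinear: "cbilinear (\<cdot>)"
    and mul_assoc: "(x \<cdot> y) \<cdot> z = x \<cdot> (y \<cdot> z)"
    and unit_mul: "\<one> \<cdot> x = x"
    and mul_unit: "x \<cdot> \<one> = x"
    and star_conjugate_linear: "conjugate_linear (star A)"
    and star_star: "star A (star A x) = x"
    and star_mul: "star A (x \<cdot> y) = star A y \<cdot> star A x"

locale star_hopf_algebra = star_algebra H
  for H :: "('h::complex_vector, 'm) star_hopf_scheme" (structure) +
  assumes comult_linear: "clinear (comult H)"
    and counit_linear: "clinear (counit H)"
    and coassoc:
      "sweedler (\<lambda>x\<^sub>1 x\<^sub>2. sweedler (\<lambda>a b. a \<otimes> b \<otimes> x\<^sub>2) (comult H x\<^sub>1)) (comult H x) =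
       sweedler (\<lambda>x\<^sub>1 x\<^sub>2. x\<^sub>1 \<otimes> comult H x\<^sub>2) (comult H x)"
    and counit_left: "sweedler (\<lambda>x\<^sub>1 x\<^sub>2. counit H x\<^sub>1 *\<^sub>C x\<^sub>2) (comult H x) = x"
    and counit_right: "sweedler (\<lambda>x\<^sub>1 x\<^sub>2. counit H x\<^sub>2 *\<^sub>C x\<^sub>1) (comult H x) = x"
    and comult_mul: "comult H (x \<cdot> y) =
      sweedler (\<lambda>x\<^sub>1 x\<^sub>2. sweedler (\<lambda>y\<^sub>1 y\<^sub>2. (x\<^sub>1 \<cdot> y\<^sub>1) \<otimes> (x\<^sub>2 \<cdot> y\<^sub>2)) (comult H y)) (comult H x)"
    and comult_unit: "comult H \<one> = \<one> \<otimes> \<one>"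
    and counit_mul: "counit H (x \<cdot> y) = counit H x * counit H y"
    and counit_unit: "counit H \<one> = 1"
    and antipode_linear: "clinear (antipode H)"
    and antipode_left:
      "sweedler (\<lambda>x\<^sub>1 x\<^sub>2. antipode H x\<^sub>1 \<cdot> x\<^sub>2) (comult H x) = counit H x *\<^sub>C \<one>"
    and antipode_right:
      "sweedler (\<lambda>x\<^sub>1 x\<^sub>2. x\<^sub>1 \<cdot> antipode H x\<^sub>2) (comult H x) = counit H x *\<^sub>C \<one>"
    and comult_star:
      "comult H (star H x) = sweedler (\<lambda>x\<^sub>1 x\<^sub>2. star H x\<^sub>1 \<otimes> star H x\<^sub>2) (comult H x)"


section \<open>The dual star algebra and the quantum double\<close>

definition dual_alg :: "('h::complex_vector, 'm) star_hopf_scheme \<Rightarrow> 'h dual star_alg"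
  where "dual_alg H =
    \<lparr> mul = (\<lambda>\<alpha> \<beta>. Abs_dual (\<lambda>x.
        sweedler (\<lambda>x\<^sub>1 x\<^sub>2. dual_apply \<alpha> x\<^sub>1 * dual_apply \<beta> x\<^sub>2) (comult H x))),
      unit = Abs_dual (counit H),
      star = (\<lambda>\<alpha>. Abs_dual (\<lambda>x. cnj (dual_apply \<alpha> (star H (antipode H x))))) \<rparr>"

definition left_hit :: "('h::complex_vector, 'm) star_alg_scheme \<Rightarrow> 'h \<Rightarrow> 'h dual \<Rightarrow> 'h dual"
    (infixr "\<rightharpoonup>\<index>" 73)
  where "left_hit H x \<alpha> = Abs_dual (\<lambda>y. dual_apply \<alpha> (y \<cdot>\<^bsub>H\<^esub> x))"

definition right_hit :: "('h::complex_vector, 'm) star_alg_scheme \<Rightarrow> 'h dual \<Rightarrow> 'h \<Rightarrow> 'h dual"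
    (infixl "\<leftharpoonup>\<index>" 73)
  where "right_hit H \<alpha> x = Abs_dual (\<lambda>y. dual_apply \<alpha> (x \<cdot>\<^bsub>H\<^esub> y))"

text \<open>
  Since \<open>H\<close> is finite dimensional, its antipode is bijective and \<open>inv (antipode H)\<close> is the genuine
  inverse.
\<close>

definition double_mul ::
    "('h::complex_vector, 'm) star_hopf_scheme \<Rightarrow>
      ('h dual, 'h) tensor \<Rightarrow> ('h dual, 'h) tensor \<Rightarrow> ('h dual, 'h) tensor"
  where "double_mul H s t =
    sweedler (\<lambda>\<alpha> x. sweedler (\<lambda>\<beta> y.
      sweedler3 H (\<lambda>x\<^sub>1 x\<^sub>2 x\<^sub>3.
        (\<alpha> \<cdot>\<^bsub>dual_alg H\<^esub> ((x\<^sub>1 \<rightharpoonup>\<^bsub>H\<^esub> \<beta>) \<leftharpoonup>\<^bsub>H\<^esub> inv (antipode H) x\<^sub>3)) \<otimes> (x\<^sub>2 \<cdot>\<^bsub>H\<^esub> y)) x) t) s"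

text \<open>
  Only the star algebra underlying the star Hopf algebra \<open>D(H)\<close> is recorded: its coalgebra structure
  plays no role for modules and invariant forms.
\<close>

definition quantum_double ::
    "('h::complex_vector, 'm) star_hopf_scheme \<Rightarrow> ('h dual, 'h) tensor star_alg"
  where "quantum_double H =
    \<lparr> mul = double_mul H,
      unit = \<one>\<^bsub>dual_alg H\<^esub> \<otimes> \<one>\<^bsub>H\<^esub>,
      star = sweedler (\<lambda>\<alpha> x.
        double_mul H (\<one>\<^bsub>dual_alg H\<^esub> \<otimes> star H x) (star (dual_alg H) \<alpha> \<otimes> \<one>\<^bsub>H\<^esub>)) \<rparr>"


section \<open>Yetter--Drinfel'd modules\<close>

definition left_module ::
    "('a::complex_vector, 'm) star_alg_scheme \<Rightarrow> ('a \<Rightarrow> 'v::complex_vector \<Rightarrow> 'v) \<Rightarrow> bool"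
  where "left_module A act \<longleftrightarrow> cbilinear act \<and>
    (\<forall>a b v. act (a \<cdot>\<^bsub>A\<^esub> b) v = act a (act b v)) \<and> (\<forall>v. act \<one>\<^bsub>A\<^esub> v = v)"

definition left_comodule ::
    "('h::complex_vector, 'm) star_hopf_scheme \<Rightarrow> ('v::complex_vector \<Rightarrow> ('h, 'v) tensor) \<Rightarrow> bool"
  where "left_comodule H coact \<longleftrightarrow> clinear coact \<and>
    (\<forall>v. sweedler (\<lambda>h w. sweedler (\<lambda>a b. a \<otimes> b \<otimes> w) (comult H h)) (coact v) =
         sweedler (\<lambda>h w. h \<otimes> coact w) (coact v)) \<and>
    (\<forall>v. sweedler (\<lambda>h w. counit H h *\<^sub>C w) (coact v) = v)"

definition yetter_drinfeld_module ::
    "('h::complex_vector, 'm) star_hopf_scheme \<Rightarrow>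
      ('h \<Rightarrow> 'v::complex_vector \<Rightarrow> 'v) \<Rightarrow> ('v \<Rightarrow> ('h, 'v) tensor) \<Rightarrow> bool"
  where "yetter_drinfeld_module H act coact \<longleftrightarrow> left_module H act \<and> left_comodule H coact \<and>
    (\<forall>x v. coact (act x v) =
      sweedler3 H (\<lambda>x\<^sub>1 x\<^sub>2 x\<^sub>3. sweedler (\<lambda>h w.
        (x\<^sub>1 \<cdot>\<^bsub>H\<^esub> h \<cdot>\<^bsub>H\<^esub> antipode H x\<^sub>3) \<otimes> act x\<^sub>2 w) (coact v)) x)"

definition dual_action ::
    "('h::complex_vector, 'm) star_hopf_scheme \<Rightarrow> ('v::complex_vector \<Rightarrow> ('h, 'v) tensor) \<Rightarrow>
      'h dual \<Rightarrow> 'v \<Rightarrow> 'v"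
  where "dual_action H coact \<alpha> v =
    sweedler (\<lambda>h w. dual_apply \<alpha> (inv (antipode H) h) *\<^sub>C w) (coact v)"

definition double_action ::
    "('h::complex_vector, 'm) star_hopf_scheme \<Rightarrow>
      ('h \<Rightarrow> 'v::complex_vector \<Rightarrow> 'v) \<Rightarrow> ('v \<Rightarrow> ('h, 'v) tensor) \<Rightarrow>
      ('h dual, 'h) tensor \<Rightarrow> 'v \<Rightarrow> 'v"
  where "double_action H act coact t v = sweedler (\<lambda>\<alpha> x. dual_action H coact \<alpha> (act x v)) t"


section \<open>Invariant Hermitian forms\<close>

definition hermitian_form :: "('v::complex_vector \<Rightarrow> 'v \<Rightarrow> complex) \<Rightarrow> bool"
  where "hermitian_form form \<longleftrightarrow>
    (\<forall>v. clinear (\<lambda>u. form u v)) \<and> (\<forall>u v. form v u = cnj (form u v))"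

definition module_invariant ::
    "('b, 'm) star_alg_scheme \<Rightarrow> ('b \<Rightarrow> 'v \<Rightarrow> 'v) \<Rightarrow> ('v \<Rightarrow> 'v \<Rightarrow> complex) \<Rightarrow> bool"
  where "module_invariant B act form \<longleftrightarrow> (\<forall>b u v. form (act b u) v = form u (act (star B b) v))"

definition comodule_invariant ::
    "('h::complex_vector, 'm) star_hopf_scheme \<Rightarrow> ('v::complex_vector \<Rightarrow> ('h, 'v) tensor) \<Rightarrow>
      ('v \<Rightarrow> 'v \<Rightarrow> complex) \<Rightarrow> bool"
  where "comodule_invariant H coact form \<longleftrightarrow>
    (\<forall>u v. sweedler (\<lambda>h w. form w v *\<^sub>C inv (antipode H) h) (coact u) =
           sweedler (\<lambda>h w. form u w *\<^sub>C star H h) (coact v))"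

end

theory Submission
  imports Defs
begin

text \<open>
  The quantum double acts by \<open>(\<alpha>x)\<cdot>v = \<alpha>\<cdot>(x\<cdot>v)\<close>, and its involution is \<open>(\<alpha>x)\<^sup>* = x\<^sup>*\<alpha>\<^sup>*\<close>. Invariance
  under \<open>D(H)\<close> therefore says that \<open>\<langle>\<alpha>\<cdot>(x\<cdot>u), v\<rangle> = \<langle>u, x\<^sup>*\<cdot>(\<alpha>\<^sup>*\<cdot>v)\<rangle>\<close> for all \<open>\<alpha>\<close> and \<open>x\<close>
  (\<open>double_invariant_iff\<close>), and this is equivalent to invariance under \<open>H\<close> together with invariance
  under \<open>H\<^sup>\<or>\<close>: put \<open>\<alpha> = \<epsilon>\<close> or \<open>x = 1\<close> in one direction, and move first \<open>\<alpha>\<close> and then \<open>x\<close> across the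
  form in the other.

  Invariance under \<open>H\<^sup>\<or>\<close> is invariance for the comodule structure (\<open>comodule_invariant_iff\<close>). Indeed
  \<open>\<langle>\<alpha>\<cdot>u, v\<rangle>\<close> is \<open>\<alpha>\<close> applied to \<open>\<Sum> S\<^sup>-\<^sup>1(u\<^sub>-\<^sub>1)\<langle>u\<^sub>0, v\<rangle>\<close>; and \<open>\<langle>u, \<alpha>\<^sup>*\<cdot>v\<rangle>\<close> is \<open>\<alpha>\<close> applied to
  \<open>\<Sum> v\<^sub>-\<^sub>1\<^sup>*\<langle>u, v\<^sub>0\<rangle>\<close>, because the antipode in the definition of \<open>\<alpha>\<^sup>*\<close> cancels the inverse antipode in the
  action of \<open>H\<^sup>\<or>\<close> and the form is conjugate linear in its second variable. Functionals separate the
  points of \<open>H\<close>, so the two sides agree for all \<open>\<alpha>\<close> exactly if the two elements of \<open>H\<close> agree.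

  What remains is that the product \<open>x\<beta>\<close>, formed in \<open>D(H)\<close>, acts as \<open>\<beta>\<close> followed by \<open>x\<close>
  (\<open>double_action_reordered_product\<close>). Here the Yetter--Drinfel'd condition enters: it gives
  \<open>x\<beta>\<cdot>v = \<Sum> \<beta>(S\<^sup>-\<^sup>1(x\<^sub>5) x\<^sub>4 S\<^sup>-\<^sup>1(v\<^sub>-\<^sub>1) S\<^sup>-\<^sup>1(x\<^sub>2) x\<^sub>1) x\<^sub>3\<cdot>v\<^sub>0\<close>,
  and the two outer pairs cancel by \<open>\<Sum> S\<^sup>-\<^sup>1(x\<^sub>2) x\<^sub>1 = \<epsilon>(x)1\<close>. This uses that the antipode is invertible,
  which for a star Hopf algebra follows from the involution: the inverse is \<open>x \<mapsto> S(x\<^sup>*)\<^sup>*\<close>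
  (\<open>inv_antipode\<close>).
\<close>

section \<open>Sweedler sums\<close>

text \<open>
  The condition for a map on pairs to factor through the tensor product as an additive map. It is weaker
  than bilinearity so as to include maps that are conjugate linear in both arguments, such as those
  that come from the involution.
\<close>

definition balanced ::
    "('a::complex_vector \<Rightarrow> 'b::complex_vector \<Rightarrow> 'c::ab_group_add) \<Rightarrow> bool"
  where "balanced f \<longleftrightarrow> (\<forall>a a' b. f (a + a') b = f a b + f a' b) \<and>
    (\<forall>a b b'. f a (b + b') = f a b + f a b') \<and> (\<forall>c a b. f (c *\<^sub>C a) b = f a (c *\<^sub>C b))"

lemma balancedI:
  assumes "\<And>a a' b. f (a + a') b = f a b + f a' b"
    and "\<And>a b b'. f a (b + b') = f a b + f a b'"
    and "\<And>c a b. f (c *\<^sub>C a) b = f a (c *\<^sub>C b)"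
  shows "balanced f"
  unfolding balanced_def by (intro conjI allI assms)

lemma scaleC_complex: "c *\<^sub>C (x :: complex) = c * x"
  by (simp add: scaleC_complex_def)

lemma clinear_iff:
  "clinear f \<longleftrightarrow> (\<forall>x y. f (x + y) = f x + f y) \<and> (\<forall>c x. f (c *\<^sub>C x) = c *\<^sub>C f x)"
  by (auto intro: clinearI simp: clinear_add clinear_scaleC)

lemma cbilinearI:
  assumes "\<And>a a' b. f (a + a') b = f a b + f a' b"
    and "\<And>a b b'. f a (b + b') = f a b + f a b'"
    and "\<And>c a b. f (c *\<^sub>C a) b = c *\<^sub>C f a b"
    and "\<And>c a b. f a (c *\<^sub>C b) = c *\<^sub>C f a b"
  shows "cbilinear f"
  unfolding cbilinear_def clinear_iff by (intro conjI allI assms)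

lemma cbilinearD:
  assumes "cbilinear f"
  shows "f (a + a') b = f a b + f a' b" "f a (b + b') = f a b + f a b'"
    "f (c *\<^sub>C a) b = c *\<^sub>C f a b" "f a (c *\<^sub>C b) = c *\<^sub>C f a b"
  using assms by (simp_all add: cbilinear_def clinear_iff)

lemma cbilinear_imp_balanced: "cbilinear f \<Longrightarrow> balanced f"
  by (rule balancedI) (simp_all only: cbilinearD)

definition ctrilinear ::
    "('a::complex_vector \<Rightarrow> 'b::complex_vector \<Rightarrow> 'c::complex_vector \<Rightarrow> 'd::complex_vector) \<Rightarrow> bool"
  where "ctrilinear F \<longleftrightarrow> (\<forall>a. cbilinear (F a)) \<and> (\<forall>b c. clinear (\<lambda>a. F a b c))"

lemma ctrilinearI:
  assumes "\<And>a a' b c. F (a + a') b c = F a b c + F a' b c"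
    and "\<And>a b b' c. F a (b + b') c = F a b c + F a b' c"
    and "\<And>a b c c'. F a b (c + c') = F a b c + F a b c'"
    and "\<And>k a b c. F (k *\<^sub>C a) b c = k *\<^sub>C F a b c"
    and "\<And>k a b c. F a (k *\<^sub>C b) c = k *\<^sub>C F a b c"
    and "\<And>k a b c. F a b (k *\<^sub>C c) = k *\<^sub>C F a b c"
  shows "ctrilinear F"
  unfolding ctrilinear_def cbilinear_def clinear_iff by (intro conjI allI assms)

lemma ctrilinearD:
  assumes "ctrilinear F"
  shows "F (a + a') b c = F a b c + F a' b c"
    "F a (b + b') c = F a b c + F a b' c"
    "F a b (c + c') = F a b c + F a b c'"
    "F (k *\<^sub>C a) b c = k *\<^sub>C F a b c"
    "F a (k *\<^sub>C b) c = k *\<^sub>C F a b c"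
    "F a b (k *\<^sub>C c) = k *\<^sub>C F a b c"
  using assms by (simp_all add: ctrilinear_def cbilinear_def clinear_iff)

lemma sweedler_abs:
  "balanced f \<Longrightarrow> sweedler f (abs_tensor M) = (\<Sum>p\<in>#M. f (fst p) (snd p))"
  by (rule sweedler_abs_tensor) (simp_all add: balanced_def)

lemma sweedler_pure: "balanced f \<Longrightarrow> sweedler f (a \<otimes> b) = f a b"
  by (simp add: pure_tensor.abs_eq sweedler_abs)

lemma sweedler_plus:
  assumes "balanced f"
  shows "sweedler f (s + t) = sweedler f s + sweedler f t"
proof (induct s rule: tensor.abs_induct, induct t rule: tensor.abs_induct)
  case (1 M N)
  then show ?case
    using assms by (simp add: plus_tensor.abs_eq sweedler_abs)
qed

lemma additive_sum_mset:
  fixes g :: "'a::ab_group_add \<Rightarrow> 'b::ab_group_add"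
  assumes "\<And>x y. g (x + y) = g x + g y"
  shows "g (\<Sum>x\<in>#M. f x) = (\<Sum>x\<in>#M. g (f x))"
proof -
  have "g 0 = 0" using assms[of 0 0] by simp
  then show ?thesis by (induction M) (simp_all add: assms)
qed

text \<open>
  An additive map may be moved under a Sweedler sum whatever the summand, since both sides are sums over
  the same presentation of the tensor. Together with \<open>sweedler_sweedler\<close> and \<open>sweedler_swap\<close>, this makes
  Sweedler sums behave like ordinary finite sums.
\<close>

lemma additive_sweedler:
  fixes g :: "'a::ab_group_add \<Rightarrow> 'b::ab_group_add"
  assumes "\<And>x y. g (x + y) = g x + g y"
  shows "g (sweedler f t) = sweedler (\<lambda>a b. g (f a b)) t"
  unfolding sweedler_def by (rule additive_sum_mset[OF assms])

lemma sweedler_sweedler: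
  "balanced f \<Longrightarrow> sweedler f (sweedler g t) = sweedler (\<lambda>a b. sweedler f (g a b)) t"
  by (rule additive_sweedler) (rule sweedler_plus)

lemma sweedler_swap:
  "sweedler (\<lambda>a b. sweedler (\<lambda>c d. f a b c d) t) s =
   sweedler (\<lambda>c d. sweedler (\<lambda>a b. f a b c d) s) t"
  unfolding sweedler_def by (rule sum_mset.swap)

lemma sweedler_add: "sweedler (\<lambda>a b. f a b + g a b) t = sweedler f t + sweedler g t"
  unfolding sweedler_def by (rule sum_mset.distrib)

lemma sweedler_scaleC:
  "sweedler (\<lambda>a b. c *\<^sub>C f a b) t = c *\<^sub>C (sweedler f t :: 'c::complex_vector)"
  by (rule additive_sweedler[symmetric]) (rule scaleC_add_right)

lemma sweedler_mult: "sweedler (\<lambda>a b. c * f a b) t = c * (sweedler f t :: complex)"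
  by (rule additive_sweedler[symmetric]) (rule distrib_left)

lemma scaleC_pure: "c *\<^sub>C (a \<otimes> b) = (c *\<^sub>C a) \<otimes> b"
  by transfer (simp add: tensor_eq.refl)

lemma pure_balanced: "(c *\<^sub>C a) \<otimes> b = a \<otimes> (c *\<^sub>C b)"
  by transfer (rule tensor_eq.balanced)

lemma pure_add:
  "(a + a') \<otimes> b = a \<otimes> b + a' \<otimes> b" "a \<otimes> (b + b') = a \<otimes> b + a \<otimes> b'"
proof -
  show "(a + a') \<otimes> b = a \<otimes> b + a' \<otimes> b"
    by transfer (use tensor_eq.add_left in \<open>simp add: add_mset_commute\<close>)
  show "a \<otimes> (b + b') = a \<otimes> b + a \<otimes> b'"
    by transfer (use tensor_eq.add_right in \<open>simp add: add_mset_commute\<close>)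
qed

lemma cbilinear_pure: "cbilinear (\<otimes>)"
  by (rule cbilinearI) (simp_all add: pure_add scaleC_pure pure_balanced)

lemma sweedler_arg_scaleC:
  fixes f :: "'a::complex_vector \<Rightarrow> 'b::complex_vector \<Rightarrow> 'c::complex_vector"
  assumes "cbilinear f"
  shows "sweedler f (c *\<^sub>C t) = c *\<^sub>C sweedler f t"
proof (induct t rule: tensor.abs_induct)
  case (1 M)
  have "(\<Sum>p\<in>#M. c *\<^sub>C f (fst p) (snd p)) = c *\<^sub>C (\<Sum>p\<in>#M. f (fst p) (snd p))"
    by (rule additive_sum_mset[symmetric]) (rule scaleC_add_right)
  then show ?case
    using cbilinear_imp_balanced[OF assms]
    by (simp add: scaleC_tensor.abs_eq sweedler_abs case_prod_unfold
        multiset.map_comp comp_def cbilinearD[OF assms])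
qed

lemma clinear_sweedler:
  fixes f :: "'a::complex_vector \<Rightarrow> 'b::complex_vector \<Rightarrow> 'c::complex_vector"
  assumes "cbilinear f"
  shows "clinear (sweedler f)"
  by (rule clinearI)
    (simp_all add: sweedler_plus cbilinear_imp_balanced sweedler_arg_scaleC assms)

lemma sweedler_cong: "(\<And>a b. f a b = g a b) \<Longrightarrow> sweedler f t = sweedler g t"
  by (simp add: sweedler_def)

lemma cbilinear_sweedler:
  assumes F: "ctrilinear F"
  shows "cbilinear (\<lambda>a. sweedler (F a))"
proof -
  have add: "F (a + a') = (\<lambda>b c. F a b c + F a' b c)" for a a'
    by (intro ext) (rule ctrilinearD[OF F])
  have scale: "F (k *\<^sub>C a) = (\<lambda>b c. k *\<^sub>C F a b c)" for k a
    by (intro ext) (rule ctrilinearD[OF F])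
  have "cbilinear (F a)" for a
    using F by (simp add: ctrilinear_def)
  from clinear_sweedler[OF this] show ?thesis
    by (intro cbilinearI)
      (simp_all only: add scale sweedler_add sweedler_scaleC clinear_add clinear_scaleC)
qed

section \<open>Functionals on a complex vector space\<close>

lemma clinear_dual_apply: "clinear (dual_apply \<alpha>)"
  using dual_apply[of \<alpha>] by simp

lemma dual_apply_simps:
  "dual_apply (\<alpha> + \<beta>) x = dual_apply \<alpha> x + dual_apply \<beta> x"
  "dual_apply (c *\<^sub>C \<alpha>) x = c * dual_apply \<alpha> x"
  "dual_apply \<alpha> (x + y) = dual_apply \<alpha> x + dual_apply \<alpha> y"
  "dual_apply \<alpha> (c *\<^sub>C x) = c * dual_apply \<alpha> x"
  using clinear_dual_apply[of \<alpha>]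
  by (simp_all add: plus_dual.rep_eq scaleC_dual.rep_eq clinear_iff scaleC_complex)

lemma dual_apply_Abs: "clinear f \<Longrightarrow> dual_apply (Abs_dual f) = f"
  by (simp add: Abs_dual_inverse)

lemma dual_eqI: "(\<And>x. dual_apply \<alpha> x = dual_apply \<beta> x) \<Longrightarrow> \<alpha> = \<beta>"
  by (metis dual_apply_inject ext)

text \<open>
  A nonzero vector extends to a basis, hence some functional takes the value \<open>1\<close> on it.
\<close>

lemma dual_separates_points:
  assumes "\<And>\<alpha>. dual_apply \<alpha> x = dual_apply \<alpha> y"
  shows "x = (y :: 'a::complex_vector)"
proof (rule ccontr)
  assume "x \<noteq> y"
  interpret vector_space_pair "scaleC :: complex \<Rightarrow> 'a \<Rightarrow> 'a" "scaleC :: complex \<Rightarrow> complex \<Rightarrow> complex"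
    by unfold_locales
  have "complex_vector.independent {x - y}"
    using \<open>x \<noteq> y\<close> by simp
  from linear_independent_extend[OF this, of "\<lambda>_. 1"]
  obtain g :: "'a \<Rightarrow> complex" where g: "clinear g" "g (x - y) = 1"
    by auto
  then have "g x = g y"
    using assms[of "Abs_dual g"] by (simp add: dual_apply_Abs)
  then show False
    using g clinear_add[OF g(1), of "x - y" y] by simp
qed

section \<open>The antipode of a star Hopf algebra and its inverse\<close>

lemma conjugate_linearD:
  assumes "conjugate_linear f"
  shows "f (x + y) = f x + f y" "f (c *\<^sub>C x) = cnj c *\<^sub>C f x"
  using assms by (simp_all add: conjugate_linear_def)

context star_algebra
begin

lemmas mul_linear = cbilinearD[OF mul_bilinear]
lemmas star_linear = conjugate_linearD[OF star_conjugate_linear]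

lemma star_unit: "star A \<one> = \<one>"
  by (metis mul_unit star_mul star_star unit_mul)

end

context star_hopf_algebra
begin

abbreviation (input) S where "S \<equiv> antipode H"
abbreviation (input) \<epsilon> where "\<epsilon> \<equiv> counit H"
abbreviation (input) \<Delta> where "\<Delta> \<equiv> comult H"

lemmas hopf_linear = clinear_add[OF comult_linear] clinear_scaleC[OF comult_linear]
  clinear_add[OF antipode_linear] clinear_scaleC[OF antipode_linear]
  clinear_add[OF counit_linear] clinear_scaleC[OF counit_linear, unfolded scaleC_complex]

lemmas linear_simps = hopf_linear mul_linear star_linear dual_apply_simps
  scaleC_add_right scaleC_add_left scaleC_scaleC pure_add

lemma cbilinear_comult_right:
  assumes "ctrilinear F"
  shows "cbilinear (\<lambda>a y. sweedler (F a) (\<Delta> y))"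
  using cbilinearD[OF cbilinear_sweedler[OF assms]]
  by (intro cbilinearI) (simp_all only: hopf_linear)

text \<open>
  Coassociativity in the form in which Sweedler calculations use it: the identity of threefold tensors
  is composed with the linear map that \<open>F\<close> induces on \<open>H \<otimes> H \<otimes> H\<close>.
\<close>

lemma sweedler_coassoc:
  assumes F: "ctrilinear F"
  shows "sweedler (\<lambda>a b. sweedler (\<lambda>c d. F c d b) (\<Delta> a)) (\<Delta> x) =
    sweedler (\<lambda>a b. sweedler (F a) (\<Delta> b)) (\<Delta> x)"
proof -
  have bF: "balanced (F a)" "cbilinear (F a)" for a
    using F by (simp_all add: ctrilinear_def cbilinear_imp_balanced)
  have b: "balanced (\<lambda>a. sweedler (F a))"
    by (rule cbilinear_imp_balanced[OF cbilinear_sweedler[OF F]])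
  from arg_cong[OF coassoc[of x], of "sweedler (\<lambda>a. sweedler (F a))"]
  show ?thesis
    by (simp add: sweedler_sweedler b sweedler_pure bF)
qed

lemma sweedler_counit_left:
  assumes "clinear f"
  shows "sweedler (\<lambda>a b. \<epsilon> a *\<^sub>C f b) (\<Delta> x) = f x"
  by (subst (2) counit_left[symmetric])
    (simp add: additive_sweedler[of f] clinear_add[OF assms] clinear_scaleC[OF assms])

lemma sweedler_counit_right:
  assumes "clinear f"
  shows "sweedler (\<lambda>a b. \<epsilon> b *\<^sub>C f a) (\<Delta> x) = f x"
  by (subst (2) counit_right[symmetric])
    (simp add: additive_sweedler[of f] clinear_add[OF assms] clinear_scaleC[OF assms])

text \<open>
  The functional \<open>x \<mapsto> cnj (\<epsilon>(x\<^sup>*))\<close> is a left counit, because \<open>\<Delta>\<close> commutes with the involution, and a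
  left counit equals any right counit.
\<close>

lemma counit_star: "\<epsilon> (star H x) = cnj (\<epsilon> x)"
proof -
  have left: "sweedler (\<lambda>a b. cnj (\<epsilon> (star H a)) *\<^sub>C b) (\<Delta> x) = x" for x
  proof -
    have "star H (sweedler (\<lambda>a b. \<epsilon> a *\<^sub>C b) (\<Delta> (star H x))) = x"
      by (simp add: counit_left star_star)
    then show ?thesis
      by (simp add: comult_star sweedler_sweedler sweedler_pure additive_sweedler[of "star H"] star_linear star_star
          balanced_def linear_simps mult.commute)
  qed
  have "\<epsilon> x = sweedler (\<lambda>a b. cnj (\<epsilon> (star H a)) * \<epsilon> b) (\<Delta> x)"
    by (subst (1) left[symmetric]) (simp add: additive_sweedler[of \<epsilon>] hopf_linear)
  also have "\<dots> = cnj (\<epsilon> (star H x))"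
    using additive_sweedler[of "\<lambda>x. cnj (\<epsilon> (star H x))" "\<lambda>a b. \<epsilon> b *\<^sub>C a" "\<Delta> x"]
    by (simp add: linear_simps counit_right mult.commute)
  finally show ?thesis
    by simp
qed

lemma antipode_unit: "S \<one> = \<one>"
proof -
  have "balanced (\<lambda>a b. S a \<cdot> b)"
    by (rule balancedI) (simp_all add: linear_simps)
  then show ?thesis
    using antipode_left[of \<one>] by (simp add: comult_unit sweedler_pure mul_unit counit_unit scaleC_one)
qed

lemma counit_antipode: "\<epsilon> (S x) = \<epsilon> x"
proof -
  have "\<epsilon> (S x) = sweedler (\<lambda>a b. \<epsilon> b *\<^sub>C \<epsilon> (S a)) (\<Delta> x)"
    by (rule sweedler_counit_right[symmetric]) (rule clinearI; simp add: linear_simps scaleC_complex)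
  also have "\<dots> = \<epsilon> (sweedler (\<lambda>a b. S a \<cdot> b) (\<Delta> x))"
    by (simp add: additive_sweedler[of \<epsilon>] hopf_linear counit_mul scaleC_complex mult.commute)
  finally show ?thesis
    by (simp add: antipode_left hopf_linear counit_unit)
qed

lemma mul_sweedler_left: "sweedler f t \<cdot> y = sweedler (\<lambda>a b. f a b \<cdot> y) t"
  by (rule additive_sweedler) (simp add: mul_linear)

lemma mul_sweedler_right: "y \<cdot> sweedler f t = sweedler (\<lambda>a b. y \<cdot> f a b) t"
  by (rule additive_sweedler) (simp add: mul_linear)

text \<open>
  In the convolution algebra of bilinear maps \<open>H \<times> H \<rightarrow> H\<close>, the map \<open>(x, y) \<mapsto> S(xy)\<close> is a left inverse of
  the product and \<open>(x, y) \<mapsto> S(y)S(x)\<close> is a right inverse. The proof is the usual argument that the two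
  agree, starting from \<open>S(y)S(x) = \<Sum> S(x\<^sub>1y\<^sub>1) x\<^sub>2y\<^sub>2 S(y\<^sub>3) S(x\<^sub>3)\<close>.
\<close>

lemma antipode_mul: "S (x \<cdot> y) = S y \<cdot> S x"
proof -
  have collapse: "sweedler (\<lambda>a b. sweedler (\<lambda>c d. S (a \<cdot> c) \<cdot> (b \<cdot> d)) (\<Delta> y)) (\<Delta> x)
      = (\<epsilon> x * \<epsilon> y) *\<^sub>C \<one>" for x y
  proof -
    have "sweedler (\<lambda>a b. S a \<cdot> b) (\<Delta> (x \<cdot> y)) = (\<epsilon> x * \<epsilon> y) *\<^sub>C \<one>"
      by (simp add: antipode_left counit_mul)
    moreover have "balanced (\<lambda>a b. S a \<cdot> b)"
      by (rule balancedI) (simp_all add: linear_simps)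
    ultimately show ?thesis
      by (simp add: comult_mul sweedler_sweedler sweedler_pure)
  qed
  \<comment> \<open>The summand for components \<open>a\<close>, \<open>b\<close>, \<open>u\<close> of \<open>x\<close> and \<open>c\<close>, \<open>d\<close>, \<open>v\<close> of \<open>y\<close>.\<close>
  define K where "K a b u c d v = S (a \<cdot> c) \<cdot> (b \<cdot> d) \<cdot> S v \<cdot> S u" for a b u c d v
  have Ky: "ctrilinear (K a b u)" for a b u
    unfolding K_def by (rule ctrilinearI; simp add: linear_simps)
  have "S y \<cdot> S x = sweedler (\<lambda>a u. \<epsilon> a *\<^sub>C (S y \<cdot> S u)) (\<Delta> x)"
    by (rule sweedler_counit_left[symmetric]) (rule clinearI; simp add: linear_simps)
  also have "\<dots> = sweedler (\<lambda>a u. sweedler (\<lambda>c v. \<epsilon> c *\<^sub>C \<epsilon> a *\<^sub>C (S v \<cdot> S u)) (\<Delta> y)) (\<Delta> x)"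
    by (rule sweedler_cong, rule sweedler_counit_left[symmetric]) (rule clinearI; simp add: linear_simps mult.commute)
  also have "\<dots> = sweedler (\<lambda>a u. sweedler (\<lambda>c v.
       sweedler (\<lambda>a b. sweedler (\<lambda>c d. S (a \<cdot> c) \<cdot> (b \<cdot> d)) (\<Delta> c)) (\<Delta> a) \<cdot> S v \<cdot> S u) (\<Delta> y)) (\<Delta> x)"
    by (simp add: collapse mul_linear unit_mul scaleC_scaleC mult.commute)
  also have "\<dots> = sweedler (\<lambda>a u. sweedler (\<lambda>c v.
       sweedler (\<lambda>a b. sweedler (\<lambda>c d. K a b u c d v) (\<Delta> c)) (\<Delta> a)) (\<Delta> y)) (\<Delta> x)"
    by (simp add: mul_sweedler_left K_def)
  also have "\<dots> = sweedler (\<lambda>a u. sweedler (\<lambda>a b. sweedler (\<lambda>c v.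
       sweedler (\<lambda>c d. K a b u c d v) (\<Delta> c)) (\<Delta> y)) (\<Delta> a)) (\<Delta> x)"
    by (rule sweedler_cong) (rule sweedler_swap)
  also have "\<dots> = sweedler (\<lambda>a u. sweedler (\<lambda>a b. sweedler (\<lambda>c v.
       sweedler (\<lambda>d v. K a b u c d v) (\<Delta> v)) (\<Delta> y)) (\<Delta> a)) (\<Delta> x)"
    by (simp add: sweedler_coassoc[OF Ky])
  also have "\<dots> = sweedler (\<lambda>a u. sweedler (\<lambda>a b. S (a \<cdot> y) \<cdot> b \<cdot> S u) (\<Delta> a)) (\<Delta> x)"
  proof (intro sweedler_cong)
    fix u a b
    have "sweedler (\<lambda>c v. sweedler (\<lambda>d v. K a b u c d v) (\<Delta> v)) (\<Delta> y) =
        sweedler (\<lambda>c v. S (a \<cdot> c) \<cdot> b \<cdot> sweedler (\<lambda>d v. d \<cdot> S v) (\<Delta> v) \<cdot> S u) (\<Delta> y)"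
      by (simp add: K_def mul_sweedler_left mul_sweedler_right mul_assoc)
    also have "\<dots> = sweedler (\<lambda>c v. \<epsilon> v *\<^sub>C (S (a \<cdot> c) \<cdot> b \<cdot> S u)) (\<Delta> y)"
      by (simp add: antipode_right linear_simps mul_unit)
    also have "\<dots> = S (a \<cdot> y) \<cdot> b \<cdot> S u"
      by (rule sweedler_counit_right) (rule clinearI; simp add: linear_simps)
    finally show "sweedler (\<lambda>c v. sweedler (\<lambda>d v. K a b u c d v) (\<Delta> v)) (\<Delta> y) = S (a \<cdot> y) \<cdot> b \<cdot> S u" .
  qed
  also have "\<dots> = sweedler (\<lambda>a u. sweedler (\<lambda>b u. S (a \<cdot> y) \<cdot> b \<cdot> S u) (\<Delta> u)) (\<Delta> x)"
    by (rule sweedler_coassoc) (rule ctrilinearI; simp add: linear_simps)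
  also have "\<dots> = sweedler (\<lambda>a u. \<epsilon> u *\<^sub>C S (a \<cdot> y)) (\<Delta> x)"
    by (simp add: mul_assoc mul_sweedler_right[symmetric] antipode_right mul_linear mul_unit)
  also have "\<dots> = S (x \<cdot> y)"
    by (rule sweedler_counit_right) (rule clinearI; simp add: linear_simps)
  finally show ?thesis ..
qed

definition skew_antipode where "skew_antipode x = star H (S (star H x))"

abbreviation (input) T where "T \<equiv> skew_antipode"

lemma skew_antipode_linear: "T (x + y) = T x + T y" "T (c *\<^sub>C x) = c *\<^sub>C T x"
  by (simp_all add: skew_antipode_def linear_simps)

lemma skew_antipode_mul: "T (x \<cdot> y) = T y \<cdot> T x"
  by (simp add: skew_antipode_def star_mul antipode_mul)

text \<open>
  The map \<open>T\<close> satisfies the antipode axioms for the opposite coproduct: they are the images under the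
  involution of the antipode axioms at \<open>x\<^sup>*\<close>.
\<close>

lemma skew_antipode_right: "sweedler (\<lambda>a b. b \<cdot> T a) (\<Delta> x) = \<epsilon> x *\<^sub>C \<one>"
proof -
  have "balanced (\<lambda>a b. S a \<cdot> b)"
    by (rule balancedI) (simp_all add: linear_simps)
  moreover have "star H (sweedler (\<lambda>a b. S a \<cdot> b) (\<Delta> (star H x))) = \<epsilon> x *\<^sub>C \<one>"
    by (simp add: antipode_left linear_simps star_unit counit_star)
  ultimately show ?thesis
    by (simp add: comult_star sweedler_sweedler sweedler_pure additive_sweedler[of "star H"]
        star_linear star_mul star_star skew_antipode_def)
qed

lemma skew_antipode_left: "sweedler (\<lambda>a b. T b \<cdot> a) (\<Delta> x) = \<epsilon> x *\<^sub>C \<one>"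
proof -
  have "balanced (\<lambda>a b. a \<cdot> S b)"
    by (rule balancedI) (simp_all add: linear_simps)
  moreover have "star H (sweedler (\<lambda>a b. a \<cdot> S b) (\<Delta> (star H x))) = \<epsilon> x *\<^sub>C \<one>"
    by (simp add: antipode_right linear_simps star_unit counit_star)
  ultimately show ?thesis
    by (simp add: comult_star sweedler_sweedler sweedler_pure additive_sweedler[of "star H"]
        star_linear star_mul star_star skew_antipode_def)
qed

text \<open>
  Since \<open>S\<close> reverses products, it turns \<open>\<Sum> x\<^sub>2 T(x\<^sub>1) = \<epsilon>(x)1\<close> into \<open>\<Sum> S(T(x\<^sub>1)) S(x\<^sub>2) = \<epsilon>(x)1\<close>. So both
  \<open>S \<circ> T\<close> and the identity are convolution inverse to \<open>S\<close>, one from each side.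
\<close>

lemma antipode_skew_antipode: "S (T x) = x"
proof -
  have inv: "sweedler (\<lambda>a b. S (T a) \<cdot> S b) (\<Delta> x) = \<epsilon> x *\<^sub>C \<one>" for x
    using arg_cong[OF skew_antipode_right[of x], of S]
    by (simp add: additive_sweedler[of S] hopf_linear antipode_mul antipode_unit)
  have "S (T x) = sweedler (\<lambda>a b. \<epsilon> b *\<^sub>C S (T a)) (\<Delta> x)"
    by (rule sweedler_counit_right[symmetric]) (rule clinearI; simp add: linear_simps skew_antipode_linear)
  also have "\<dots> = sweedler (\<lambda>a b. sweedler (\<lambda>b c. S (T a) \<cdot> S b \<cdot> c) (\<Delta> b)) (\<Delta> x)"
    by (simp add: mul_assoc mul_sweedler_right[symmetric] antipode_left mul_linear mul_unit)
  also have "\<dots> = sweedler (\<lambda>a c. sweedler (\<lambda>a b. S (T a) \<cdot> S b \<cdot> c) (\<Delta> a)) (\<Delta> x)"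
    by (rule sweedler_coassoc[symmetric]) (rule ctrilinearI; simp add: linear_simps skew_antipode_linear)
  also have "\<dots> = sweedler (\<lambda>a c. \<epsilon> a *\<^sub>C c) (\<Delta> x)"
    by (simp add: mul_sweedler_left[symmetric] inv mul_linear unit_mul)
  finally show ?thesis
    by (simp add: counit_left)
qed

text \<open>
  The composites \<open>S \<circ> T\<close> and \<open>T \<circ> S\<close> are conjugate under the involution.
\<close>

lemma skew_antipode_antipode: "T (S x) = x"
  using antipode_skew_antipode[of "star H x"] by (simp add: skew_antipode_def star_star)

lemma inv_antipode: "inv (antipode H) = T"
  by (rule inv_equality) (simp_all add: antipode_skew_antipode skew_antipode_antipode)

lemma counit_skew_antipode: "\<epsilon> (T x) = \<epsilon> x"
  by (simp add: skew_antipode_def counit_star counit_antipode)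

section \<open>Products in the dual algebra and in the quantum double\<close>

lemma dual_mul_apply:
  "dual_apply (\<alpha> \<cdot>\<^bsub>dual_alg H\<^esub> \<beta>) x = sweedler (\<lambda>a b. dual_apply \<alpha> a * dual_apply \<beta> b) (\<Delta> x)"
proof -
  have b: "cbilinear (\<lambda>a b. dual_apply \<alpha> a * dual_apply \<beta> b)"
    by (rule cbilinearI) (simp_all add: linear_simps algebra_simps scaleC_complex)
  have "clinear (\<lambda>x. sweedler (\<lambda>a b. dual_apply \<alpha> a * dual_apply \<beta> b) (\<Delta> x))"
    using clinear_sweedler[OF b] by (simp add: clinear_iff hopf_linear)
  then show ?thesis
    by (simp add: dual_alg_def dual_apply_Abs)
qed

lemma dual_unit_apply: "dual_apply \<one>\<^bsub>dual_alg H\<^esub> x = \<epsilon> x"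
  by (simp add: dual_alg_def dual_apply_Abs counit_linear)

lemma dual_star_apply: "dual_apply (star (dual_alg H) \<alpha>) x = cnj (dual_apply \<alpha> (star H (S x)))"
proof -
  have "clinear (\<lambda>x. cnj (dual_apply \<alpha> (star H (S x))))"
    by (rule clinearI) (simp_all add: linear_simps scaleC_complex)
  then show ?thesis
    by (simp add: dual_alg_def dual_apply_Abs)
qed

lemma left_hit_apply: "dual_apply (x \<rightharpoonup>\<^bsub>H\<^esub> \<alpha>) y = dual_apply \<alpha> (y \<cdot> x)"
proof -
  have "clinear (\<lambda>y. dual_apply \<alpha> (y \<cdot> x))"
    by (rule clinearI) (simp_all add: linear_simps scaleC_complex)
  then show ?thesis
    by (simp add: left_hit_def dual_apply_Abs)
qed

lemma right_hit_apply: "dual_apply (\<alpha> \<leftharpoonup>\<^bsub>H\<^esub> x) y = dual_apply \<alpha> (x \<cdot> y)"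
proof -
  have "clinear (\<lambda>y. dual_apply \<alpha> (x \<cdot> y))"
    by (rule clinearI) (simp_all add: linear_simps scaleC_complex)
  then show ?thesis
    by (simp add: right_hit_def dual_apply_Abs)
qed

lemma dual_unit_mul: "\<one>\<^bsub>dual_alg H\<^esub> \<cdot>\<^bsub>dual_alg H\<^esub> \<alpha> = \<alpha>"
proof (rule dual_eqI)
  fix x
  show "dual_apply (\<one>\<^bsub>dual_alg H\<^esub> \<cdot>\<^bsub>dual_alg H\<^esub> \<alpha>) x = dual_apply \<alpha> x"
    using sweedler_counit_left[OF clinear_dual_apply, of \<alpha> x]
    by (simp add: dual_mul_apply dual_unit_apply scaleC_complex)
qed

lemma dual_star_unit: "star (dual_alg H) \<one>\<^bsub>dual_alg H\<^esub> = \<one>\<^bsub>dual_alg H\<^esub>"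
  by (rule dual_eqI) (simp add: dual_star_apply dual_unit_apply counit_star counit_antipode)

lemma dual_mul_linear:
  "(\<alpha> + \<alpha>') \<cdot>\<^bsub>dual_alg H\<^esub> \<beta> = \<alpha> \<cdot>\<^bsub>dual_alg H\<^esub> \<beta> + \<alpha>' \<cdot>\<^bsub>dual_alg H\<^esub> \<beta>"
  "\<alpha> \<cdot>\<^bsub>dual_alg H\<^esub> (\<beta> + \<beta>') = \<alpha> \<cdot>\<^bsub>dual_alg H\<^esub> \<beta> + \<alpha> \<cdot>\<^bsub>dual_alg H\<^esub> \<beta>'"
  "(c *\<^sub>C \<alpha>) \<cdot>\<^bsub>dual_alg H\<^esub> \<beta> = c *\<^sub>C (\<alpha> \<cdot>\<^bsub>dual_alg H\<^esub> \<beta>)"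
  "\<alpha> \<cdot>\<^bsub>dual_alg H\<^esub> (c *\<^sub>C \<beta>) = c *\<^sub>C (\<alpha> \<cdot>\<^bsub>dual_alg H\<^esub> \<beta>)"
  by (rule dual_eqI; simp add: dual_mul_apply linear_simps ring_distribs sweedler_add mult.assoc
      mult.left_commute[of _ c] sweedler_mult)+

text \<open>
  The functional that appears in the product of \<open>D(H)\<close> when an element of \<open>H\<close> is moved to the right of \<open>\<beta>\<close>;
  on the diagonal, with \<open>x\<close> and \<open>z\<close> the outer Sweedler components of one element, it is a coadjoint
  action of that element on \<open>\<beta>\<close>.
\<close>

definition coadjoint where "coadjoint x \<beta> z = (x \<rightharpoonup>\<^bsub>H\<^esub> \<beta>) \<leftharpoonup>\<^bsub>H\<^esub> inv (antipode H) z"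

lemma coadjoint_apply: "dual_apply (coadjoint x \<beta> z) y = dual_apply \<beta> (T z \<cdot> y \<cdot> x)"
  by (simp add: coadjoint_def right_hit_apply left_hit_apply inv_antipode)

lemma ctrilinear_coadjoint: "ctrilinear coadjoint"
  by (rule ctrilinearI; rule dual_eqI; simp add: coadjoint_apply linear_simps skew_antipode_linear)

text \<open>
  The summand in the product of \<open>D(H)\<close> is linear in \<open>\<alpha>\<close>, \<open>\<beta>\<close>, \<open>y\<close> and in each component of \<open>x\<close>, so the
  product may be computed from any presentation of its factors.
\<close>

lemma double_mul_pure:
  "double_mul H (\<alpha> \<otimes> x) (\<beta> \<otimes> y) =
    sweedler3 H (\<lambda>a b c. (\<alpha> \<cdot>\<^bsub>dual_alg H\<^esub> coadjoint a \<beta> c) \<otimes> (b \<cdot> y)) x"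
proof -
  define G where "G \<alpha> \<beta> y a b c = (\<alpha> \<cdot>\<^bsub>dual_alg H\<^esub> coadjoint a \<beta> c) \<otimes> (b \<cdot> y)" for \<alpha> \<beta> y a b c
  note G_simps = G_def linear_simps ctrilinearD[OF ctrilinear_coadjoint] dual_mul_linear
    cbilinearD[OF cbilinear_pure]
  have G3: "ctrilinear (G \<alpha> \<beta> y)" for \<alpha> \<beta> y
    by (rule ctrilinearI; simp add: G_simps)
  have G: "clinear (sweedler3 H (G \<alpha> \<beta> y))" for \<alpha> \<beta> y
    using clinear_sweedler[OF cbilinear_comult_right[OF G3]]
    by (simp add: sweedler3_def clinear_iff hopf_linear)
  have GG: "cbilinear (\<lambda>\<beta> y. sweedler3 H (G \<alpha> \<beta> y) x)" for \<alpha> x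
    by (rule cbilinearI)
      (simp_all add: sweedler3_def G_simps sweedler_add sweedler_scaleC)
  have "cbilinear (\<lambda>\<alpha> x. sweedler3 H (G \<alpha> \<beta> y) x)" for \<beta> y
    by (rule cbilinearI)
      (simp_all add: clinear_add[OF G] clinear_scaleC[OF G],
       simp_all add: sweedler3_def G_simps sweedler_add sweedler_scaleC)
  then have "balanced (\<lambda>\<alpha> x. sweedler (\<lambda>\<beta> y. sweedler3 H (G \<alpha> \<beta> y) x) (\<beta> \<otimes> y))"
    by (simp add: sweedler_pure cbilinear_imp_balanced GG)
  then show ?thesis
    unfolding double_mul_def coadjoint_def[symmetric] G_def[symmetric]
    by (simp add: sweedler_pure cbilinear_imp_balanced GG)
qed

end

section \<open>The action of the quantum double on a Yetter--Drinfel'd module\<close>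

locale yetter_drinfeld = star_hopf_algebra H
  for H :: "('h::complex_vector, 'm) star_hopf_scheme" (structure) +
  fixes act :: "'h \<Rightarrow> 'v::complex_vector \<Rightarrow> 'v" and coact :: "'v \<Rightarrow> ('h, 'v) tensor"
  assumes yd: "yetter_drinfeld_module H act coact"
begin

lemma act_bilinear: "cbilinear act" and act_unit: "act \<one> v = v" and coact_linear: "clinear coact"
  and coact_counit: "sweedler (\<lambda>h w. counit H h *\<^sub>C w) (coact v) = v"
  and coact_act: "coact (act x v) =
      sweedler3 H (\<lambda>a b c. sweedler (\<lambda>h w. (a \<cdot> h \<cdot> antipode H c) \<otimes> act b w) (coact v)) x"
  using yd by (auto simp: yetter_drinfeld_module_def left_module_def left_comodule_def)

lemmas act_linear = cbilinearD[OF act_bilinear]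
lemmas coact_simps = clinear_add[OF coact_linear] clinear_scaleC[OF coact_linear]

lemma dual_action_eq:
  "dual_action H coact \<alpha> v = sweedler (\<lambda>h w. dual_apply \<alpha> (T h) *\<^sub>C w) (coact v)"
  by (simp add: dual_action_def inv_antipode)

lemma cbilinear_dual_action_summand: "cbilinear (\<lambda>h w. dual_apply \<alpha> (T h) *\<^sub>C w)"
  by (rule cbilinearI) (simp_all add: linear_simps skew_antipode_linear mult.commute)

lemma cbilinear_dual_action: "cbilinear (dual_action H coact)"
  by (rule cbilinearI)
    (simp_all add: dual_action_eq coact_simps linear_simps sweedler_add
      sweedler_scaleC[symmetric]
      clinear_add[OF clinear_sweedler[OF cbilinear_dual_action_summand]]
      clinear_scaleC[OF clinear_sweedler[OF cbilinear_dual_action_summand]])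

lemma dual_action_act:
  "dual_action H coact \<alpha> (act x v) = sweedler3 H (\<lambda>a b c.
    sweedler (\<lambda>h w. dual_apply \<alpha> (T (a \<cdot> h \<cdot> S c)) *\<^sub>C act b w) (coact v)) x"
  by (simp add: dual_action_eq coact_act sweedler3_def sweedler_sweedler sweedler_pure
      cbilinear_imp_balanced[OF cbilinear_dual_action_summand])

lemma dual_action_unit: "dual_action H coact \<one>\<^bsub>dual_alg H\<^esub> v = v"
  by (simp add: dual_action_eq dual_unit_apply counit_skew_antipode coact_counit)

lemma balanced_double_action: "balanced (\<lambda>\<alpha> x. dual_action H coact \<alpha> (act x v))"
  by (rule balancedI) (simp_all add: cbilinearD[OF cbilinear_dual_action] act_linear)

text \<open>
  This is the part of the module axiom for \<open>D(H)\<close> that involves its twisted product. Expanding the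
  coaction of \<open>x\<^sub>2\<cdot>v\<close> gives a Sweedler sum over five components of \<open>x\<close>, in which the two on the left and the
  two on the right of the middle one cancel in turn.
\<close>

lemma double_action_reordered_product:
  "double_action H act coact
     (double_mul H (\<one>\<^bsub>dual_alg H\<^esub> \<otimes> x) (\<beta> \<otimes> \<one>)) v = act x (dual_action H coact \<beta> v)"
proof -
  \<comment> \<open>The summand; \<open>a\<close>, \<open>b\<close>, \<open>c\<close>, \<open>d\<close>, \<open>e\<close> are the components of \<open>x\<close> in the order of the coproduct.\<close>
  define K where "K h w e d b a c = dual_apply \<beta> (T e \<cdot> d \<cdot> T h \<cdot> T b \<cdot> a) *\<^sub>C act c w" for h w e d b a c
  note K_simps = K_def linear_simps skew_antipode_linear act_linear mult.commute
  have "double_action H act coact (double_mul H (\<one>\<^bsub>dual_alg H\<^esub> \<otimes> x) (\<beta> \<otimes> \<one>)) v =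
     sweedler3 H (\<lambda>a y e. dual_action H coact (coadjoint a \<beta> e) (act y v)) x"
    by (simp add: double_action_def double_mul_pure dual_unit_mul mul_unit sweedler3_def
        sweedler_sweedler sweedler_pure balanced_double_action)
  also have "\<dots> = sweedler3 H (\<lambda>a y e. sweedler3 H (\<lambda>b c d. sweedler (\<lambda>h w. K h w e d b a c) (coact v)) y) x"
    by (simp add: dual_action_act coadjoint_apply skew_antipode_mul skew_antipode_antipode mul_assoc K_def)
  also have "\<dots> = sweedler (\<lambda>h w. sweedler3 H (\<lambda>a y e. sweedler3 H (\<lambda>b c d. K h w e d b a c) y) x) (coact v)"
    by (simp add: sweedler3_def sweedler_swap[of _ _ "coact v"])
  also have "\<dots> = sweedler (\<lambda>h w. dual_apply \<beta> (T h) *\<^sub>C act x w) (coact v)"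
  proof (rule sweedler_cong)
    fix h w
    define F where "F a b z e = sweedler (\<lambda>c d. K h w e d b a c) (\<Delta> z)" for a b z e
    have F: "ctrilinear (F a)" for a
    proof -
      have "cbilinear (\<lambda>c d. K h w e d b a c)" for e b
        by (rule cbilinearI) (simp_all add: K_simps)
      note z = clinear_sweedler[OF this]
      have K: "K h w (e + e') d b a c = K h w e d b a c + K h w e' d b a c"
        "K h w e d (b + b') a c = K h w e d b a c + K h w e d b' a c"
        "K h w (k *\<^sub>C e) d b a c = k *\<^sub>C K h w e d b a c"
        "K h w e d (k *\<^sub>C b) a c = k *\<^sub>C K h w e d b a c" for e e' d b b' c k
        by (simp_all add: K_simps)
      show ?thesis
        unfolding F_def
        by (intro ctrilinearI)
          (simp_all only: hopf_linear clinear_add[OF z] clinear_scaleC[OF z] K sweedler_add sweedler_scaleC)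
    qed
    \<comment> \<open>Cancel the last two of the three components of \<open>u\<close>.\<close>
    have "sweedler (\<lambda>z e. F a b z e) (\<Delta> u) = dual_apply \<beta> (T h \<cdot> T b \<cdot> a) *\<^sub>C act u w" for a b u
    proof -
      have "sweedler (\<lambda>z e. F a b z e) (\<Delta> u) =
          sweedler (\<lambda>c n. sweedler (\<lambda>d e. K h w e d b a c) (\<Delta> n)) (\<Delta> u)"
        unfolding F_def by (rule sweedler_coassoc) (rule ctrilinearI; simp add: K_simps)
      also have "\<dots> = sweedler (\<lambda>c n. dual_apply \<beta>
          (sweedler (\<lambda>d e. T e \<cdot> d) (\<Delta> n) \<cdot> (T h \<cdot> T b \<cdot> a)) *\<^sub>C act c w) (\<Delta> u)"
        unfolding mul_sweedler_left
        by (subst additive_sweedler[of "\<lambda>y. dual_apply \<beta> y *\<^sub>C act _ w"])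
          (simp_all add: linear_simps K_def mul_assoc)
      also have "\<dots> = sweedler (\<lambda>c n. \<epsilon> n *\<^sub>C dual_apply \<beta> (T h \<cdot> T b \<cdot> a) *\<^sub>C act c w) (\<Delta> u)"
        by (simp add: skew_antipode_left linear_simps unit_mul)
      also have "\<dots> = dual_apply \<beta> (T h \<cdot> T b \<cdot> a) *\<^sub>C act u w"
        by (rule sweedler_counit_right) (rule clinearI; simp add: linear_simps act_linear mult.commute)
      finally show ?thesis .
    qed
    then have "sweedler3 H (\<lambda>a y e. sweedler3 H (\<lambda>b c d. K h w e d b a c) y) x =
      sweedler (\<lambda>a m. sweedler (\<lambda>b u. dual_apply \<beta> (T h \<cdot> T b \<cdot> a) *\<^sub>C act u w) (\<Delta> m)) (\<Delta> x)"
      by (simp add: sweedler3_def F_def[symmetric] sweedler_coassoc[OF F])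
    \<comment> \<open>Cancel the first two components in the same way.\<close>
    also have "\<dots> = sweedler (\<lambda>s u. sweedler (\<lambda>a b. dual_apply \<beta> (T h \<cdot> T b \<cdot> a) *\<^sub>C act u w) (\<Delta> s)) (\<Delta> x)"
      by (rule sweedler_coassoc[symmetric])
        (rule ctrilinearI; simp add: linear_simps skew_antipode_linear act_linear mult.commute)
    also have "\<dots> = sweedler (\<lambda>s u. dual_apply \<beta>
        (T h \<cdot> sweedler (\<lambda>a b. T b \<cdot> a) (\<Delta> s)) *\<^sub>C act u w) (\<Delta> x)"
      unfolding mul_sweedler_right
      by (subst additive_sweedler[of "\<lambda>y. dual_apply \<beta> y *\<^sub>C act _ w"])
        (simp_all add: linear_simps mul_assoc)
    also have "\<dots> = sweedler (\<lambda>s u. \<epsilon> s *\<^sub>C dual_apply \<beta> (T h) *\<^sub>C act u w) (\<Delta> x)"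
      by (simp add: skew_antipode_left linear_simps mul_unit)
    also have "\<dots> = dual_apply \<beta> (T h) *\<^sub>C act x w"
      by (rule sweedler_counit_left) (rule clinearI; simp add: linear_simps act_linear mult.commute)
    finally show "sweedler3 H (\<lambda>a y e. sweedler3 H (\<lambda>b c d. K h w e d b a c) y) x =
      dual_apply \<beta> (T h) *\<^sub>C act x w" .
  qed
  also have "\<dots> = act x (dual_action H coact \<beta> v)"
    by (simp add: dual_action_eq additive_sweedler[of "act x"] act_linear)
  finally show ?thesis .
qed

lemma double_action_star:
  "double_action H act coact (star (quantum_double H) t) v =
    sweedler (\<lambda>\<alpha> x. act (star H x) (dual_action H coact (star (dual_alg H) \<alpha>) v)) t"
  using double_action_reordered_product
  by (simp add: quantum_double_def double_action_def sweedler_sweedler balanced_double_action)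

end

section \<open>Invariance of Hermitian forms\<close>

lemma hermitian_formD:
  assumes "hermitian_form form"
  shows "form (u + u') v = form u v + form u' v" "form (c *\<^sub>C u) v = c * form u v"
    "form u (v + v') = form u v + form u v'" "form u (c *\<^sub>C v) = cnj c * form u v"
proof -
  have lin: "clinear (\<lambda>u. form u v)" and herm: "form v u = cnj (form u v)" for u v
    using assms unfolding hermitian_form_def by blast+
  show left: "form (u + u') v = form u v + form u' v" "form (c *\<^sub>C u) v = c * form u v" for u u' v c
    using lin[of v] by (simp_all add: clinear_iff scaleC_complex)
  show "form u (v + v') = form u v + form u v'" "form u (c *\<^sub>C v) = cnj c * form u v"
    using herm[of u] herm[of _ u] left by (metis complex_cnj_add complex_cnj_mult)+
qed

context yetter_drinfeld
begin

text \<open>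
  Both sides of the invariance condition at a tensor \<open>t\<close> are Sweedler sums over \<open>t\<close>, so it suffices to
  compare the summands at pure tensors. The vector in the second argument of the form depends conjugate
  linearly on \<open>\<alpha>\<close> and \<open>x\<close>, and the form depends conjugate linearly on that vector; so the summand is
  bilinear in \<open>\<alpha>\<close> and \<open>x\<close>.
\<close>

lemma double_invariant_iff:
  assumes "hermitian_form form"
  shows "module_invariant (quantum_double H) (double_action H act coact) form \<longleftrightarrow>
    (\<forall>\<alpha> x u v. form (dual_action H coact \<alpha> (act x u)) v =
      form u (act (star H x) (dual_action H coact (star (dual_alg H) \<alpha>) v)))"
    (is "?inv \<longleftrightarrow> (\<forall>\<alpha> x u v. ?L u v \<alpha> x = ?R u v \<alpha> x)")
proof -
  note form = hermitian_formD[OF assms]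
  have star: "star (dual_alg H) (\<alpha> + \<beta>) = star (dual_alg H) \<alpha> + star (dual_alg H) \<beta>"
    "star (dual_alg H) (c *\<^sub>C \<alpha>) = cnj c *\<^sub>C star (dual_alg H) \<alpha>" for \<alpha> \<beta> c
    by (rule dual_eqI; simp add: dual_star_apply linear_simps)+
  have L: "balanced (?L u v)" and R: "balanced (?R u v)" for u v
    by (rule balancedI; simp add: form cbilinearD[OF cbilinear_dual_action] act_linear star star_linear)+
  have l: "form (double_action H act coact t u) v = sweedler (?L u v) t" for t u v
    unfolding double_action_def by (rule additive_sweedler[of "\<lambda>w. form w v"]) (rule form)
  have r: "form u (double_action H act coact (star (quantum_double H) t) v) = sweedler (?R u v) t" for t u v
    unfolding double_action_star by (rule additive_sweedler[of "form u"]) (rule form)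
  show ?thesis
  proof
    assume ?inv
    then have "sweedler (?L u v) (\<alpha> \<otimes> x) = sweedler (?R u v) (\<alpha> \<otimes> x)" for \<alpha> x u v
      unfolding module_invariant_def l r by blast
    then show "\<forall>\<alpha> x u v. ?L u v \<alpha> x = ?R u v \<alpha> x"
      by (simp add: sweedler_pure L R)
  next
    assume "\<forall>\<alpha> x u v. ?L u v \<alpha> x = ?R u v \<alpha> x"
    then show ?inv
      unfolding module_invariant_def l r by simp
  qed
qed

text \<open>
  Applying a functional \<open>\<alpha>\<close> to the two sides of the comodule condition gives the two sides of invariance
  under \<open>\<alpha>\<close>, and functionals separate points.
\<close>

lemma comodule_invariant_iff:
  assumes "hermitian_form form"
  shows "comodule_invariant H coact form \<longleftrightarrow>
    (\<forall>\<alpha> u v. form (dual_action H coact \<alpha> u) v = form u (dual_action H coact (star (dual_alg H) \<alpha>) v))"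
proof -
  note form = hermitian_formD[OF assms]
  have l: "form (dual_action H coact \<alpha> u) v =
      dual_apply \<alpha> (sweedler (\<lambda>h w. form w v *\<^sub>C inv (antipode H) h) (coact u))" for \<alpha> u v
    by (simp add: dual_action_def additive_sweedler[of "\<lambda>w. form w v"]
        additive_sweedler[of "dual_apply \<alpha>"] form(1,2) dual_apply_simps mult.commute)
  have r: "form u (dual_action H coact (star (dual_alg H) \<alpha>) v) =
      dual_apply \<alpha> (sweedler (\<lambda>h w. form u w *\<^sub>C star H h) (coact v))" for \<alpha> u v
    by (simp add: dual_action_eq additive_sweedler[of "form u"] dual_star_apply antipode_skew_antipode
        additive_sweedler[of "dual_apply \<alpha>"] form(3,4) dual_apply_simps mult.commute)
  show ?thesis
    unfolding comodule_invariant_def l r by (auto intro: dual_separates_points)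
qed

end

theorem proposition4p6:
  fixes H :: "'h::complex_vector star_hopf"
    and act :: "'h \<Rightarrow> 'v::complex_vector \<Rightarrow> 'v"
    and coact :: "'v \<Rightarrow> ('h, 'v) tensor"
    and form :: "'v \<Rightarrow> 'v \<Rightarrow> complex"
  assumes "star_hopf_algebra H"
    and "\<exists>B :: 'h set. finite B \<and> complex_vector.span B = UNIV"
    and "yetter_drinfeld_module H act coact"
    and "hermitian_form form"
  shows "module_invariant (quantum_double H) (double_action H act coact) form \<longleftrightarrow>
    module_invariant H act form \<and> comodule_invariant H coact form"
proof -
  interpret yetter_drinfeld H act coact
    using assms(1,3) by (simp add: yetter_drinfeld_def yetter_drinfeld_axioms_def)
  note form_iffs = double_invariant_iff[OF assms(4)] comodule_invariant_iff[OF assms(4)]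
    module_invariant_def[of H]
  show ?thesis
  proof
    assume "module_invariant (quantum_double H) (double_action H act coact) form"
    then have double: "form (dual_action H coact \<alpha> (act x u)) v =
        form u (act (star H x) (dual_action H coact (star (dual_alg H) \<alpha>) v))" for \<alpha> x u v
      unfolding form_iffs by blast
    have "form (act x u) v = form u (act (star H x) v)" for x u v
      using double[of "\<one>\<^bsub>dual_alg H\<^esub>" x u v] by (simp add: dual_star_unit dual_action_unit)
    moreover have "form (dual_action H coact \<alpha> u) v =
        form u (dual_action H coact (star (dual_alg H) \<alpha>) v)" for \<alpha> u v
      using double[of \<alpha> "\<one>\<^bsub>H\<^esub>" u v] by (simp add: star_unit act_unit)
    ultimately show "module_invariant H act form \<and> comodule_invariant H coact form"
      unfolding form_iffs by blast
  next
    assume "module_invariant H act form \<and> comodule_invariant H coact form"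
    then show "module_invariant (quantum_double H) (double_action H act coact) form"
      unfolding form_iffs by simp
  qed
qed

end
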